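(* Let $m\ge 3$ be an odd integer, let $(G,+,0)$ be an abelian group whose exponent divides $m-1$, and let $u,v\in G$. The operation $F_m(G;u,v)$ on $X(G)=G\mathbin{\dot\cup}\{a,b\}$ is a symmetric idempotent $m$-ary semigroup, and $$\operatorname{Con}(F_m(G;u,v))=\{\theta_N^{\varepsilon,\delta}: N\le G,\ \varepsilon,\delta\in\{0,1\}\}.$$ Moreover, the map $(N,\varepsilon,\delta)\mapsto\theta_N^{\varepsilon,\delta}$ is a lattice isomorphism $$\operatorname{Sub}(G)\times B_2\cong\operatorname{Con}(F_m(G;u,v)).$$ Regard $F_m(G;u,v)$ as an alternating two-sorted operation on two copies of $X(G)$. A carrier--index pair $(\theta,\phi)$ of equivalence relations on $X(G)$ is a typed congruence if and only if $$\theta\in\operatorname{Con}(F_m(G;u,v))\quad\text{and}\quad\phi\subseteq\theta.$$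
   Context: An $m$-ary operation $F:X^m\to X$ is an $m$-ary semigroup if it is associative: $F(x_1,\dots,x_{i},F(x_{i+1},\dots,x_{i+m}),x_{i+m+1},\dots,x_{2m-1})$ does not depend on $i\in\{0,\dots,m-1\}$. It is symmetric if it is invariant under permutations of its arguments, and idempotent if $F(x,\dots,x)=x$. $\operatorname{Con}(F)$ is the set of equivalence relations on $X$ compatible with $F$ (ordinary congruences), ordered by inclusion. The exponent of $G$ divides $m-1$ means $(m-1)g=0$ for all $g\in G$. Define $\tau:X(G)\to G$ by $\tau(a)=u$, $\tau(b)=v$, $\tau(g)=g$ for $g\in G$. The operation $F_m=F_m(G;u,v):X(G)^m\to X(G)$ is: $F_m(x_1,\dots,x_m)=a$ if $x_1=\dots=x_m=a$; $F_m(x_1,\dots,x_m)=b$ if $x_1=\dots=x_m=b$; and $F_m(x_1,\dots,x_m)=\tau(x_1)+\dots+\tau(x_m)$ otherwise. For a subgroup $N\le G$ and $\varepsilon,\delta\in\{0,1\}$, $\theta_N^{\varepsilon,\delta}$ is the following equivalence on $X(G)$: its restriction to $G$ is congruence modulo $N$; if $\varepsilon=1$, $a$ is adjoined to the class of the coset $u+N$, otherwise $\{a\}$ is a singleton class; if $\delta=1$, $b$ is adjoined to the class of the coset $v+N$, otherwise $\{b\}$ is a singleton class (so if $\varepsilon=\delta=1$ and $u-v\in N$, then $a$ and $b$ lie in the same class). $\operatorname{Sub}(G)$ is the lattice of subgroups of $G$, and $B_2=\{0,1\}^2$ is the Boolean lattice with $2$ atoms, whose elements are written $(\varepsilon,\delta)$.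 In the alternating two-sorted view, the odd positions $1,3,\dots,m$ are carrier entries, the even positions $2,4,\dots,m-1$ are index entries, the output is a carrier element, and both sorts have underlying set $X(G)$. A pair $(\theta,\phi)$ of equivalence relations on $X(G)$ is a typed congruence if, whenever $x_i\mathrel\theta x_i'$ for all odd $i$ and $x_i\mathrel\phi x_i'$ for all even $i$, one has $F_m(x_1,\dots,x_m)\mathrel\theta F_m(x_1',\dots,x_m')$. *)

theory Defs
  imports
    "HOL-Algebra.Coset"
    "HOL-Algebra.FiniteProduct"
    "HOL-Algebra.Lattice"
    "HOL-Combinatorics.Permutations"
begin

text \<open>
  Abelian groups are \<open>comm_group\<close>s of HOL-Algebra, hence written multiplicatively: \<open>\<otimes>\<close>, \<open>\<one>\<close>,
  \<open>[^]\<close> and \<open>\<Otimes>\<close> play the roles of the sum, the zero, integer multiples and iterated sums.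
  An argument tuple \<open>(x\<^sub>1, \<dots>, x\<^sub>m)\<close> is a list of length \<open>m\<close> in which \<open>x\<^sub>j\<close> has list index \<open>j - 1\<close>.
\<close>

definition tuples :: "nat \<Rightarrow> 'x set \<Rightarrow> 'x list set" where
  "tuples m X = {xs. length xs = m \<and> set xs \<subseteq> X}"

definition operation :: "nat \<Rightarrow> 'x set \<Rightarrow> ('x list \<Rightarrow> 'x) \<Rightarrow> bool" where
  "operation m X F \<longleftrightarrow> (\<forall>xs \<in> tuples m X. F xs \<in> X)"

definition bracket :: "nat \<Rightarrow> ('x list \<Rightarrow> 'x) \<Rightarrow> nat \<Rightarrow> 'x list \<Rightarrow> 'x" where
  "bracket m F i xs = F (take i xs @ [F (take m (drop i xs))] @ drop (i + m) xs)"

definition associative_op :: "nat \<Rightarrow> 'x set \<Rightarrow> ('x list \<Rightarrow> 'x) \<Rightarrow> bool" where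
  "associative_op m X F \<longleftrightarrow>
     (\<forall>xs \<in> tuples (2 * m - 1) X. \<forall>i < m. \<forall>j < m. bracket m F i xs = bracket m F j xs)"

definition mary_semigroup :: "nat \<Rightarrow> 'x set \<Rightarrow> ('x list \<Rightarrow> 'x) \<Rightarrow> bool" where
  "mary_semigroup m X F \<longleftrightarrow> operation m X F \<and> associative_op m X F"

definition symmetric_op :: "nat \<Rightarrow> 'x set \<Rightarrow> ('x list \<Rightarrow> 'x) \<Rightarrow> bool" where
  "symmetric_op m X F \<longleftrightarrow>
     (\<forall>xs \<in> tuples m X. \<forall>p. p permutes {..<m} \<longrightarrow> F (permute_list p xs) = F xs)"

definition idempotent_op :: "nat \<Rightarrow> 'x set \<Rightarrow> ('x list \<Rightarrow> 'x) \<Rightarrow> bool" where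
  "idempotent_op m X F \<longleftrightarrow> (\<forall>x \<in> X. F (replicate m x) = x)"

definition Con :: "nat \<Rightarrow> 'x set \<Rightarrow> ('x list \<Rightarrow> 'x) \<Rightarrow> 'x rel set" where
  "Con m X F = {\<theta>. equiv X \<theta> \<and>
     (\<forall>xs \<in> tuples m X. \<forall>ys \<in> tuples m X.
        (\<forall>i < m. (xs ! i, ys ! i) \<in> \<theta>) \<longrightarrow> (F xs, F ys) \<in> \<theta>)}"

text \<open>
  Positions are counted from 1, so the odd positions (carrier entries) are the even list indices
  and the even positions (index entries) are the odd list indices.
\<close>

definition typed_congruence ::
    "nat \<Rightarrow> 'x set \<Rightarrow> ('x list \<Rightarrow> 'x) \<Rightarrow> 'x rel \<Rightarrow> 'x rel \<Rightarrow> bool" where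
  "typed_congruence m X F \<theta> \<phi> \<longleftrightarrow> equiv X \<theta> \<and> equiv X \<phi> \<and>
     (\<forall>xs \<in> tuples m X. \<forall>ys \<in> tuples m X.
        (\<forall>i < m. even i \<longrightarrow> (xs ! i, ys ! i) \<in> \<theta>) \<longrightarrow>
        (\<forall>i < m. odd i \<longrightarrow> (xs ! i, ys ! i) \<in> \<phi>) \<longrightarrow> (F xs, F ys) \<in> \<theta>)"

datatype 'g ext = Elem 'g | PtA | PtB

definition ext_carrier :: "('g, 'k) monoid_scheme \<Rightarrow> 'g ext set" where
  "ext_carrier G = Elem ` carrier G \<union> {PtA, PtB}"

fun tau :: "'g \<Rightarrow> 'g \<Rightarrow> 'g ext \<Rightarrow> 'g" where
  "tau u v (Elem g) = g"
| "tau u v PtA = u"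
| "tau u v PtB = v"

definition Fop :: "nat \<Rightarrow> ('g, 'k) monoid_scheme \<Rightarrow> 'g \<Rightarrow> 'g \<Rightarrow> 'g ext list \<Rightarrow> 'g ext" where
  "Fop m G u v xs =
     (if \<forall>i < m. xs ! i = PtA then PtA
      else if \<forall>i < m. xs ! i = PtB then PtB
      else Elem (\<Otimes>\<^bsub>G\<^esub>i \<in> {..<m}. tau u v (xs ! i)))"

text \<open>The flags \<open>\<epsilon>\<close> and \<open>\<delta>\<close> are Booleans, with \<open>False\<close> for 0 and \<open>True\<close> for 1.\<close>

definition coset_class ::
    "('g, 'k) monoid_scheme \<Rightarrow> 'g \<Rightarrow> 'g \<Rightarrow> 'g set \<Rightarrow> bool \<Rightarrow> bool \<Rightarrow> 'g set \<Rightarrow> 'g ext set" where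
  "coset_class G u v N \<epsilon> \<delta> C =
     Elem ` C \<union> {x. x = PtA \<and> \<epsilon> \<and> C = N #>\<^bsub>G\<^esub> u} \<union> {x. x = PtB \<and> \<delta> \<and> C = N #>\<^bsub>G\<^esub> v}"

definition theta_classes ::
    "('g, 'k) monoid_scheme \<Rightarrow> 'g \<Rightarrow> 'g \<Rightarrow> 'g set \<Rightarrow> bool \<Rightarrow> bool \<Rightarrow> 'g ext set set" where
  "theta_classes G u v N \<epsilon> \<delta> =
     coset_class G u v N \<epsilon> \<delta> ` (rcosets\<^bsub>G\<^esub> N)
     \<union> (if \<epsilon> then {} else {{PtA}}) \<union> (if \<delta> then {} else {{PtB}})"

definition theta ::
    "('g, 'k) monoid_scheme \<Rightarrow> 'g \<Rightarrow> 'g \<Rightarrow> 'g set \<Rightarrow> bool \<Rightarrow> bool \<Rightarrow> 'g ext rel" where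
  "theta G u v N \<epsilon> \<delta> = {(x, y). \<exists>K \<in> theta_classes G u v N \<epsilon> \<delta>. x \<in> K \<and> y \<in> K}"

definition inclusion_order :: "'a set set \<Rightarrow> 'a set gorder" where
  "inclusion_order S = \<lparr>carrier = S, eq = (=), le = (\<subseteq>)\<rparr>"

definition prod_order :: "'a gorder \<Rightarrow> 'b gorder \<Rightarrow> ('a \<times> 'b) gorder" where
  "prod_order L M = \<lparr>carrier = carrier L \<times> carrier M, eq = (=),
     le = (\<lambda>(x, y) (x', y'). x \<sqsubseteq>\<^bsub>L\<^esub> x' \<and> y \<sqsubseteq>\<^bsub>M\<^esub> y')\<rparr>"

definition Sub :: "('g, 'k) monoid_scheme \<Rightarrow> 'g set gorder" where
  "Sub G = inclusion_order {N. subgroup N G}"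

definition chain2 :: "bool gorder" where
  "chain2 = \<lparr>carrier = UNIV, eq = (=), le = (\<le>)\<rparr>"

definition B2 :: "(bool \<times> bool) gorder" where
  "B2 = prod_order chain2 chain2"

text \<open>\<open>join_pres\<close> and \<open>meet_pres\<close> also assert that both orders are lattices.\<close>

definition lattice_iso :: "'a gorder \<Rightarrow> 'b gorder \<Rightarrow> ('a \<Rightarrow> 'b) \<Rightarrow> bool" where
  "lattice_iso L M f \<longleftrightarrow>
     bij_betw f (carrier L) (carrier M) \<and> join_pres L M f \<and> meet_pres L M f"

end

theory Submission
  imports Defs "HOL-Algebra.Divisibility"
begin

text \<open>
  The \<open>\<tau>\<close>-image of a value of \<open>F\<close> is the product of the \<open>\<tau>\<close>-images of the arguments; for the two
  exceptional values this holds because the exponent divides \<open>m - 1\<close>. Two distinct points are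
  related by \<open>\<theta>\<^sub>N\<close> exactly when neither forms a singleton class by fiat and their \<open>\<tau>\<close>-images are
  congruent modulo \<open>N\<close>. Conversely, changing the first entry of \<open>(x, \<dots>, x)\<close> and of
  \<open>(x, \<one>, \<dots>, \<one>)\<close> from \<open>x\<close> to a related \<open>y \<noteq> x\<close> gives \<open>x \<approx> \<tau> y\<close> and \<open>\<tau> x \<approx> \<tau> y\<close>, so a
  congruence is determined by its restriction to the group and by whether \<open>a \<approx> u\<close> and \<open>b \<approx> v\<close>.
  Only translations in one carrier position are used, so the carrier part of a typed congruence is
  classified in the same way; the same changes made in an index position give \<open>\<phi> \<subseteq> \<theta>\<close>.
\<close>

subsection \<open>Lattice isomorphisms\<close>

lemma partial_order_inclusion_order: "partial_order (inclusion_order S)"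
  unfolding inclusion_order_def by unfold_locales auto

text \<open>As \<open>f\<close> is onto and both preserves and reflects the order, the upper bounds
  of the image of \<open>A\<close> are exactly the images of the upper bounds of \<open>A\<close>,
  and least ones correspond.\<close>

lemma least_Upper_image:
  assumes f: "bij_betw f (carrier L) (carrier M)"
    and le: "\<And>x y. x \<in> carrier L \<Longrightarrow> y \<in> carrier L \<Longrightarrow> f x \<sqsubseteq>\<^bsub>M\<^esub> f y \<longleftrightarrow> x \<sqsubseteq>\<^bsub>L\<^esub> y"
    and A: "A \<subseteq> carrier L" and s: "least L s (Upper L A)"
  shows "least M (f s) (Upper M (f ` A))"
proof -
  have M: "carrier M = f ` carrier L" using f by (simp add: bij_betw_def)
  have mem: "f z \<in> Upper M (f ` A) \<longleftrightarrow> z \<in> Upper L A" if "z \<in> carrier L" for z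
  proof -
    have "f z \<in> Upper M (f ` A) \<longleftrightarrow> (\<forall>x\<in>A. f x \<sqsubseteq>\<^bsub>M\<^esub> f z)"
      using A that by (auto simp: Upper_def M)
    also have "\<dots> \<longleftrightarrow> z \<in> Upper L A"
      using A that le by (auto simp: Upper_def subset_iff)
    finally show ?thesis .
  qed
  have sL: "s \<in> carrier L" "s \<in> Upper L A"
    using s by (auto simp: least_def Upper_def)
  show ?thesis
    unfolding least_def
  proof (intro conjI ballI)
    show "f s \<in> Upper M (f ` A)" using sL mem by simp
    fix y assume y: "y \<in> Upper M (f ` A)"
    then obtain z where z: "y = f z" "z \<in> carrier L" by (auto simp: Upper_def M)
    then have "s \<sqsubseteq>\<^bsub>L\<^esub> z" using s y mem by (auto simp: least_def)
    then show "f s \<sqsubseteq>\<^bsub>M\<^esub> y" using z sL le by simp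
  qed (auto simp: Upper_def)
qed

lemma greatest_Lower_image:
  assumes f: "bij_betw f (carrier L) (carrier M)"
    and le: "\<And>x y. x \<in> carrier L \<Longrightarrow> y \<in> carrier L \<Longrightarrow> f x \<sqsubseteq>\<^bsub>M\<^esub> f y \<longleftrightarrow> x \<sqsubseteq>\<^bsub>L\<^esub> y"
    and A: "A \<subseteq> carrier L" and s: "greatest L s (Lower L A)"
  shows "greatest M (f s) (Lower M (f ` A))"
proof -
  have M: "carrier M = f ` carrier L" using f by (simp add: bij_betw_def)
  have mem: "f z \<in> Lower M (f ` A) \<longleftrightarrow> z \<in> Lower L A" if "z \<in> carrier L" for z
  proof -
    have "f z \<in> Lower M (f ` A) \<longleftrightarrow> (\<forall>x\<in>A. f z \<sqsubseteq>\<^bsub>M\<^esub> f x)"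
      using A that by (auto simp: Lower_def M)
    also have "\<dots> \<longleftrightarrow> z \<in> Lower L A"
      using A that le by (auto simp: Lower_def subset_iff)
    finally show ?thesis .
  qed
  have sL: "s \<in> carrier L" "s \<in> Lower L A"
    using s by (auto simp: greatest_def Lower_def)
  show ?thesis
    unfolding greatest_def
  proof (intro conjI ballI)
    show "f s \<in> Lower M (f ` A)" using sL mem by simp
    fix y assume y: "y \<in> Lower M (f ` A)"
    then obtain z where z: "y = f z" "z \<in> carrier L" by (auto simp: Lower_def M)
    then have "z \<sqsubseteq>\<^bsub>L\<^esub> s" using s y mem by (auto simp: greatest_def)
    then show "y \<sqsubseteq>\<^bsub>M\<^esub> f s" using z sL le by simp
  qed (auto simp: Lower_def)
qed

text \<open>Joins and meets are transported from \<open>L\<close>, so \<open>M\<close> only has to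
  be a partial order beforehand. This suits \<open>Con\<close>, which is known to be ordered by
  inclusion but whose joins have not been computed.\<close>

lemma lattice_iso_of_order_iso:
  assumes "lattice L" and "partial_order M"
    and f: "bij_betw f (carrier L) (carrier M)"
    and le: "\<And>x y. x \<in> carrier L \<Longrightarrow> y \<in> carrier L \<Longrightarrow> f x \<sqsubseteq>\<^bsub>M\<^esub> f y \<longleftrightarrow> x \<sqsubseteq>\<^bsub>L\<^esub> y"
  shows "lattice_iso L M f"
proof -
  interpret L: lattice L by fact
  interpret M: partial_order M by fact
  have lub: "least M (f (x \<squnion>\<^bsub>L\<^esub> y)) (Upper M {f x, f y})" if "x \<in> carrier L" "y \<in> carrier L" for x y
    using least_Upper_image[OF f le, of "{x, y}"] that L.sup_of_two_least[of x y]
    by (simp add: join_def)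
  have glb: "greatest M (f (x \<sqinter>\<^bsub>L\<^esub> y)) (Lower M {f x, f y})"
    if "x \<in> carrier L" "y \<in> carrier L" for x y
    using greatest_Lower_image[OF f le, of "{x, y}"] that L.inf_of_two_greatest[of x y]
    by (simp add: meet_def)
  have M: "carrier M = f ` carrier L" using f by (simp add: bij_betw_def)
  interpret M: lattice M
  proof
    show "\<exists>s. least M s (Upper M {x, y})" if "x \<in> carrier M" "y \<in> carrier M" for x y
      using that lub unfolding M by blast
    show "\<exists>s. greatest M s (Lower M {x, y})" if "x \<in> carrier M" "y \<in> carrier M" for x y
      using that glb unfolding M by blast
  qed
  have "f (x \<squnion>\<^bsub>L\<^esub> y) = f x \<squnion>\<^bsub>M\<^esub> f y" "f (x \<sqinter>\<^bsub>L\<^esub> y) = f x \<sqinter>\<^bsub>M\<^esub> f y"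
    if "x \<in> carrier L" "y \<in> carrier L" for x y
  proof -
    have "f x \<in> carrier M" "f y \<in> carrier M" using that M by auto
    then show "f (x \<squnion>\<^bsub>L\<^esub> y) = f x \<squnion>\<^bsub>M\<^esub> f y" "f (x \<sqinter>\<^bsub>L\<^esub> y) = f x \<sqinter>\<^bsub>M\<^esub> f y"
      using M.least_unique[OF lub[OF that] M.sup_of_two_least]
        M.greatest_unique[OF glb[OF that] M.inf_of_two_greatest]
      by (auto simp: join_def meet_def)
  qed
  then show ?thesis
    unfolding lattice_iso_def join_pres_def meet_pres_def
    using f L.lattice_axioms M.lattice_axioms by blast
qed

section \<open>Products of lattices, and the factors \<open>B2\<close> and
  \<open>Sub G\<close>\<close>

lemma lattice_prod_order:
  assumes "lattice L" and "lattice M"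
  shows "lattice (prod_order L M)"
proof -
  interpret L: lattice L by fact
  interpret M: lattice M by fact
  interpret P: partial_order "prod_order L M"
    unfolding prod_order_def
    by unfold_locales (auto intro: L.le_trans M.le_trans)
  show ?thesis
  proof
    fix x y
    assume "x \<in> carrier (prod_order L M)" "y \<in> carrier (prod_order L M)"
    then obtain x1 x2 y1 y2 where xy: "x = (x1, x2)" "y = (y1, y2)"
      and 1: "x1 \<in> carrier L" "y1 \<in> carrier L" and 2: "x2 \<in> carrier M" "y2 \<in> carrier M"
      by (auto simp: prod_order_def)
    obtain s1 s2 where "least L s1 (Upper L {x1, y1})" "least M s2 (Upper M {x2, y2})"
      using L.sup_of_two_exists[OF 1] M.sup_of_two_exists[OF 2] by blast
    then have "least (prod_order L M) (s1, s2) (Upper (prod_order L M) {x, y})"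
      using 1 2 unfolding least_def Upper_def xy by (auto simp: prod_order_def)
    then show "\<exists>s. least (prod_order L M) s (Upper (prod_order L M) {x, y})" ..
    obtain i1 i2 where "greatest L i1 (Lower L {x1, y1})" "greatest M i2 (Lower M {x2, y2})"
      using L.inf_of_two_exists[OF 1] M.inf_of_two_exists[OF 2] by blast
    then have "greatest (prod_order L M) (i1, i2) (Lower (prod_order L M) {x, y})"
      using 1 2 unfolding greatest_def Lower_def xy by (auto simp: prod_order_def)
    then show "\<exists>s. greatest (prod_order L M) s (Lower (prod_order L M) {x, y})" ..
  qed
qed

lemma lattice_B2: "lattice B2"
proof -
  interpret total_order chain2
    unfolding chain2_def by unfold_locales auto
  have "lattice chain2" ..
  then show ?thesis unfolding B2_def by (intro lattice_prod_order)
qed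

lemma (in group) lattice_Sub: "lattice (Sub G)"
proof -
  interpret complete_lattice "Sub G"
    unfolding Sub_def inclusion_order_def by (rule subgroups_complete_lattice)
  show ?thesis ..
qed

subsection \<open>The extended operation\<close>

locale extended_group = comm_group G for G (structure) +
  fixes m :: nat and u v
  assumes m_ge: "m \<ge> 3"
    and exponent: "g \<in> carrier G \<Longrightarrow> g [^] (m - 1) = \<one>"
    and u_closed [simp]: "u \<in> carrier G" and v_closed [simp]: "v \<in> carrier G"
begin

abbreviation "X \<equiv> ext_carrier G"
abbreviation "F \<equiv> Fop m G u v"
abbreviation "\<tau> \<equiv> tau u v"

text \<open>A list form of the indexed product in \<open>Fop\<close>: it splits along concatenation,
  and \<open>multlist_perm_cong\<close> applies to it. The link is
  \<open>finprod_eq_total\<close>.\<close>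

definition total where
  "total xs = foldr (\<otimes>) (map \<tau> xs) \<one>"

lemma Elem_in_X [simp]: "Elem g \<in> X \<longleftrightarrow> g \<in> carrier G"
  and PtA_in_X [simp]: "PtA \<in> X" and PtB_in_X [simp]: "PtB \<in> X"
  by (auto simp: ext_carrier_def)

lemma tau_closed [simp]: "x \<in> X \<Longrightarrow> \<tau> x \<in> carrier G"
  by (auto simp: ext_carrier_def)

lemma total_Nil [simp]: "total [] = \<one>"
  and total_Cons [simp]: "total (x # xs) = \<tau> x \<otimes> total xs"
  by (simp_all add: total_def)

lemma total_closed [simp]: "set xs \<subseteq> X \<Longrightarrow> total xs \<in> carrier G"
  by (induction xs) auto

lemma total_append [simp]:
  "set xs \<subseteq> X \<Longrightarrow> set ys \<subseteq> X \<Longrightarrow> total (xs @ ys) = total xs \<otimes> total ys"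
  by (induction xs) (auto simp: m_assoc)

lemma total_replicate [simp]: "x \<in> X \<Longrightarrow> total (replicate n x) = \<tau> x [^] n"
  by (induction n) (auto simp: m_comm)

lemma total_permute:
  assumes "mset xs = mset ys" "set ys \<subseteq> X"
  shows "total xs = total ys"
proof -
  have "set xs \<subseteq> X" using assms by (metis mset_eq_setD)
  then show ?thesis
    unfolding total_def using assms
    by (intro multlist_perm_cong) auto
qed

lemma finprod_eq_total:
  "set xs \<subseteq> X \<Longrightarrow> (\<Otimes>i\<in>{..<length xs}. \<tau> (xs ! i)) = total xs"
\<comment> \<open>Induction from the right end, since enlarging \<open>{..<n}\<close> to
  \<open>{..<Suc n}\<close> adds the last index.\<close>
proof (induction xs rule: rev_induct)
  case Nil
  then show ?case by simp
next
  case (snoc x xs)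
  have cl: "i < length xs \<Longrightarrow> \<tau> (xs ! i) \<in> carrier G" for i
    using snoc.prems by (metis tau_closed le_supE nth_mem set_append subset_iff)
  have "(\<Otimes>i\<in>{..<length xs}. \<tau> ((xs @ [x]) ! i)) = (\<Otimes>i\<in>{..<length xs}. \<tau> (xs ! i))"
    using cl by (intro finprod_cong') (auto simp: nth_append)
  then show ?case
    using snoc cl by (simp add: lessThan_Suc finprod_insert Pi_iff nth_append m_comm)
qed

lemma pow_m [simp]: "g \<in> carrier G \<Longrightarrow> g [^] m = g"
  using exponent[of g] m_ge nat_pow_Suc[of g "m - 1"] by simp

lemma tuples_ne: "xs \<in> tuples m X \<Longrightarrow> xs \<noteq> []"
  using m_ge by (auto simp: tuples_def)

text \<open>Testing the set of entries instead of the positions makes the order of the arguments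
  irrelevant to the case distinction.\<close>

lemma Fop_eq:
  assumes "xs \<in> tuples m X"
  shows "F xs = (if set xs = {PtA} then PtA else if set xs = {PtB} then PtB else Elem (total xs))"
proof -
  \<comment> \<open>Right to left is immediate; left to right uses that a tuple is nonempty, so its
    set of entries is not empty.\<close>
  have "(\<forall>i<m. xs ! i = c) \<longleftrightarrow> set xs = {c}" for c
    using assms tuples_ne[OF assms] by (auto simp: tuples_def set_conv_nth)
  then show ?thesis
    using assms finprod_eq_total[of xs] by (auto simp: Fop_def tuples_def)
qed

lemma tau_Fop [simp]:
  assumes "xs \<in> tuples m X"
  shows "\<tau> (F xs) = total xs"
proof -
  have rep: "set xs = {c} \<Longrightarrow> xs = replicate m c" for c
    using assms by (metis (mono_tags, lifting) mem_Collect_eq replicate_eqI singletonD tuples_def)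
  \<comment> \<open>For a constant tuple the product is the \<open>m\<close>-th power of
    \<open>\<tau> c\<close>, which is \<open>\<tau> c\<close> by \<open>pow_m\<close>.\<close>
  have "set xs = {c} \<Longrightarrow> total xs = \<tau> c" if "c \<in> X" for c
    using that by (subst rep) auto
  then show ?thesis using Fop_eq[OF assms] by auto
qed

lemma Fop_closed [simp]: "xs \<in> tuples m X \<Longrightarrow> F xs \<in> X"
  using Fop_eq[of xs] by (auto simp: tuples_def)

lemma Fop_Pt_iff:
  assumes "xs \<in> tuples m X"
  shows "F xs = PtA \<longleftrightarrow> set xs = {PtA}" "F xs = PtB \<longleftrightarrow> set xs = {PtB}"
  using Fop_eq[OF assms] by auto

lemma Fop_cong:
  assumes "xs \<in> tuples m X" "ys \<in> tuples m X"
    and "total xs = total ys" "set xs = {PtA} \<longleftrightarrow> set ys = {PtA}" "set xs = {PtB} \<longleftrightarrow> set ys = {PtB}"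
  shows "F xs = F ys"
  using assms Fop_eq[of xs] Fop_eq[of ys] by simp

text \<open>The inner value carries the product of its block, and it is a special point exactly when
  the block is constant at that point. Hence bracketing changes neither the product nor the two
  constancy tests. The right-hand side is free of \<open>i\<close>, which is associativity.\<close>

lemma bracket_eq:
  assumes xs: "xs \<in> tuples (2 * m - 1) X" and "i < m"
  shows "bracket m F i xs =
    (if set xs = {PtA} then PtA else if set xs = {PtB} then PtB else Elem (total xs))"
proof -
  define p b s where "p = take i xs" and "b = take m (drop i xs)" and "s = drop (i + m) xs"
  have eq: "xs = p @ b @ s"
    unfolding p_def b_def s_def by (metis add.commute append_take_drop_id drop_drop)
  have X: "set p \<subseteq> X" "set b \<subseteq> X" "set s \<subseteq> X"
    using xs unfolding eq tuples_def by auto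
  have b: "b \<in> tuples m X"
    using xs \<open>i < m\<close> X by (auto simp: b_def tuples_def)
  have o: "p @ [F b] @ s \<in> tuples m X"
    using xs \<open>i < m\<close> X Fop_closed[OF b] by (auto simp: p_def s_def tuples_def)
  have "total (p @ [F b] @ s) = total xs"
    unfolding eq using X b by (simp add: m_assoc)
  moreover have "set (p @ [F b] @ s) = {c} \<longleftrightarrow> set xs = {c}" if "F b = c \<longleftrightarrow> set b = {c}" for c
  proof -
    \<comment> \<open>With a nonempty block, being constant at \<open>c\<close> amounts to inclusion
      in \<open>{c}\<close>, a condition that can be checked on each piece, even if \<open>p\<close>
      or \<open>s\<close> is empty.\<close>
    have "set b \<noteq> {}" using tuples_ne[OF b] by simp
    then have "F b = c \<longleftrightarrow> set b \<subseteq> {c}" using that by (simp add: subset_singleton_iff)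
    moreover have "set (p @ [F b] @ s) = {c} \<longleftrightarrow> F b = c \<and> set p \<subseteq> {c} \<and> set s \<subseteq> {c}"
      by auto
    moreover have "set xs = {c} \<longleftrightarrow> set b \<subseteq> {c} \<and> set p \<subseteq> {c} \<and> set s \<subseteq> {c}"
    proof -
      have "set xs = {c} \<longleftrightarrow> set xs \<subseteq> {c}"
        unfolding eq using \<open>set b \<noteq> {}\<close> by (simp add: subset_singleton_iff)
      then show ?thesis unfolding eq by auto
    qed
    ultimately show ?thesis by simp
  qed
  note this[OF Fop_Pt_iff(1)[OF b]] this[OF Fop_Pt_iff(2)[OF b]]
  ultimately have "F (p @ [F b] @ s) =
      (if set xs = {PtA} then PtA else if set xs = {PtB} then PtB else Elem (total xs))"
    using Fop_eq[OF o] by (simp only:)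
  then show ?thesis
    unfolding bracket_def p_def b_def s_def .
qed

lemma mary_semigroup_Fop: "mary_semigroup m X F"
  unfolding mary_semigroup_def operation_def associative_op_def
  using bracket_eq by simp

lemma symmetric_Fop: "symmetric_op m X F"
  unfolding symmetric_op_def
proof (intro ballI allI impI)
  fix xs p assume xs: "xs \<in> tuples m X" and p: "p permutes {..<m}"
  then have len: "length xs = m" by (simp add: tuples_def)
  have ms: "mset (permute_list p xs) = mset xs"
    using p len by simp
  then have st: "set (permute_list p xs) = set xs" by (rule mset_eq_setD)
  show "F (permute_list p xs) = F xs"
    using xs st total_permute[OF ms] by (intro Fop_cong) (auto simp: tuples_def)
qed

lemma replicate_tuple: "x \<in> X \<Longrightarrow> replicate m x \<in> tuples m X"
  by (auto simp: tuples_def)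

lemma idempotent_Fop: "idempotent_op m X F"
  unfolding idempotent_op_def
proof
  fix x assume x: "x \<in> X"
  have "set (replicate m x) = {x}" using m_ge by simp
  then show "F (replicate m x) = x"
    using x by (cases x) (auto simp: Fop_eq[OF replicate_tuple])
qed

subsection \<open>The relations \<open>theta\<close>\<close>

text \<open>Marks the points lying in the class of a coset, namely that of their
  \<open>\<tau>\<close>-image; an unattached point is a singleton class.\<close>

fun attached :: "bool \<Rightarrow> bool \<Rightarrow> 'a ext \<Rightarrow> bool" where
  "attached \<epsilon> \<delta> (Elem g) \<longleftrightarrow> True"
| "attached \<epsilon> \<delta> PtA \<longleftrightarrow> \<epsilon>"
| "attached \<epsilon> \<delta> PtB \<longleftrightarrow> \<delta>"

lemma r_coset_eq_iff_mem:
  assumes "subgroup N G" "g \<in> carrier G" "h \<in> carrier G"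
  shows "N #> g = N #> h \<longleftrightarrow> g \<in> N #> h"
proof
  assume "N #> g = N #> h"
  then show "g \<in> N #> h" using rcos_self[OF assms(2,1)] by simp
next
  assume "g \<in> N #> h"
  then show "N #> g = N #> h" using repr_independence[OF _ assms(3,1)] by simp
qed

lemma r_coset_eq_iff:
  assumes "subgroup N G" "g \<in> carrier G" "h \<in> carrier G"
  shows "N #> g = N #> h \<longleftrightarrow> g \<otimes> inv h \<in> N"
  unfolding r_coset_eq_iff_mem[OF assms] subgroup.rcos_module[OF assms(1) is_group assms(3,2)] ..

text \<open>Passing through \<open>\<tau>\<close> merges three conditions into one:
  \<open>Elem g\<close> belongs to the coset of \<open>g\<close>, \<open>PtA\<close> to that of
  \<open>u\<close>, \<open>PtB\<close> to that of \<open>v\<close>.\<close>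

lemma mem_coset_class_iff:
  assumes N: "subgroup N G" and C: "C \<in> rcosets N" and x: "x \<in> X"
  shows "x \<in> coset_class G u v N \<epsilon> \<delta> C \<longleftrightarrow> attached \<epsilon> \<delta> x \<and> C = N #> \<tau> x"
proof (cases x)
  case (Elem g)
  obtain h where "h \<in> carrier G" "C = N #> h" using C by (auto simp: RCOSETS_def)
  then have "g \<in> C \<longleftrightarrow> C = N #> g"
    using r_coset_eq_iff_mem[OF N, of g h] x Elem by auto
  then show ?thesis using Elem by (auto simp: coset_class_def)
qed (auto simp: coset_class_def)

lemma coset_class_subset:
  assumes "subgroup N G" "C \<in> rcosets N"
  shows "coset_class G u v N \<epsilon> \<delta> C \<subseteq> X"
  using subgroup.rcosets_carrier[OF assms(1) is_group assms(2)] by (auto simp: coset_class_def)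

text \<open>Replaces the partition by a pointwise test. The disjunct \<open>x = y\<close> accounts
  for the singleton classes of unattached points.\<close>

lemma theta_iff:
  assumes N: "subgroup N G"
  shows "(x, y) \<in> theta G u v N \<epsilon> \<delta> \<longleftrightarrow> x \<in> X \<and> y \<in> X \<and>
    (x = y \<or> attached \<epsilon> \<delta> x \<and> attached \<epsilon> \<delta> y \<and> N #> \<tau> x = N #> \<tau> y)"
    (is "?L \<longleftrightarrow> ?R")
proof
  assume ?L
  then obtain K where K: "K \<in> theta_classes G u v N \<epsilon> \<delta>" "x \<in> K" "y \<in> K"
    by (auto simp: theta_def)
  then consider C where "C \<in> rcosets N" "K = coset_class G u v N \<epsilon> \<delta> C"
    | "K = {PtA}" | "K = {PtB}"
    by (auto simp: theta_classes_def split: if_splits)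
  then show ?R
  proof cases
    case 1
    then have "x \<in> X" "y \<in> X" using K coset_class_subset[OF N] by blast+
    then show ?thesis using K 1 mem_coset_class_iff[OF N 1(1)] by metis
  qed (use K in auto)
next
  assume R: ?R
  then have X: "x \<in> X" "y \<in> X" by auto
  have C: "N #> \<tau> x \<in> rcosets N"
    using X by (intro rcosetsI subgroup.subset[OF N]) auto
  show ?L
  proof (cases "attached \<epsilon> \<delta> x \<and> attached \<epsilon> \<delta> y \<and> N #> \<tau> x = N #> \<tau> y")
    case True
    then show ?thesis
      using mem_coset_class_iff[OF N C] X C unfolding theta_def theta_classes_def by blast
  next
    case False
    \<comment> \<open>Only \<open>PtA\<close> or \<open>PtB\<close> with its flag off remains, and
      its singleton is one of the listed classes.\<close>
    with R have "x = y" "\<not> attached \<epsilon> \<delta> x" by auto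
    then show ?thesis by (cases x) (auto simp: theta_def theta_classes_def)
  qed
qed

lemma equiv_theta:
  assumes "subgroup N G"
  shows "equiv X (theta G u v N \<epsilon> \<delta>)"
proof (rule equivI)
  show "theta G u v N \<epsilon> \<delta> \<subseteq> X \<times> X"
    by (rule subrelI) (simp add: theta_iff[OF assms])
  show "refl_on X (theta G u v N \<epsilon> \<delta>)"
    by (rule refl_onI) (simp add: theta_iff[OF assms])
  show "sym (theta G u v N \<epsilon> \<delta>)"
    unfolding sym_def theta_iff[OF assms] by metis
  show "trans (theta G u v N \<epsilon> \<delta>)"
    unfolding trans_def theta_iff[OF assms] by metis
qed

text \<open>An unattached value is \<open>PtA\<close> or \<open>PtB\<close>, taken only on the
  constant tuple. All entries are then unattached, so \<open>rel\<close> forces the two tuples to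
  coincide.\<close>

lemma attached_Fop:
  assumes xs: "xs \<in> tuples m X" and ys: "ys \<in> tuples m X"
    and rel: "\<forall>i<m. xs ! i = ys ! i \<or> attached \<epsilon> \<delta> (xs ! i)"
    and neq: "F xs \<noteq> F ys"
  shows "attached \<epsilon> \<delta> (F xs)"
proof (rule ccontr)
  assume na: "\<not> attached \<epsilon> \<delta> (F xs)"
  have "F xs = PtA \<or> F xs = PtB" using na by (metis attached.simps(1) ext.exhaust)
  then have "set xs = {F xs}" using Fop_Pt_iff[OF xs] by metis
  then have "\<forall>i<m. xs ! i = F xs"
    using xs by (metis (mono_tags, lifting) mem_Collect_eq nth_mem singletonD tuples_def)
  then have "\<forall>i<m. xs ! i = ys ! i" using rel na by metis
  then have "xs = ys" using xs ys by (auto simp: tuples_def intro: nth_equalityI)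
  with neq show False by simp
qed

lemma theta_in_Con:
  assumes N: "subgroup N G"
  shows "theta G u v N \<epsilon> \<delta> \<in> Con m X F"
  unfolding Con_def
proof (intro CollectI conjI ballI impI equiv_theta[OF N])
  fix xs ys
  assume xs: "xs \<in> tuples m X" and ys: "ys \<in> tuples m X"
    and "\<forall>i<m. (xs ! i, ys ! i) \<in> theta G u v N \<epsilon> \<delta>"
  then have rel: "\<forall>i<m. xs ! i = ys ! i \<or> attached \<epsilon> \<delta> (xs ! i) \<and> attached \<epsilon> \<delta> (ys ! i)
      \<and> N #> \<tau> (xs ! i) = N #> \<tau> (ys ! i)"
    by (simp add: theta_iff[OF N])
  \<comment> \<open>Normality, automatic in an abelian group, allows cosets to be multiplied by
    \<open>rcos_sum\<close>.\<close>
  interpret normal N G using N by (rule subgroup_imp_normal)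
  have "list_all2 (\<lambda>x y. x \<in> X \<and> y \<in> X \<and> N #> \<tau> x = N #> \<tau> y) xs ys"
    using rel xs ys unfolding list_all2_conv_all_nth tuples_def
    by (auto simp: subset_iff)
  then have "N #> total xs = N #> total ys \<and> set xs \<subseteq> X \<and> set ys \<subseteq> X"
  proof induction
    case (Cons x xs y ys)
    have "(N #> \<tau> x) <#> (N #> total xs) = (N #> \<tau> y) <#> (N #> total ys)"
      using Cons by simp
    moreover have "\<tau> x \<in> carrier G" "\<tau> y \<in> carrier G"
        "total xs \<in> carrier G" "total ys \<in> carrier G"
      using Cons by simp_all
    ultimately have "N #> total (x # xs) = N #> total (y # ys)"
      unfolding total_Cons by (metis rcos_sum)
    then show ?case using Cons by simp
  qed simp
  then have tot: "N #> total xs = N #> total ys" by simp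
  have "attached \<epsilon> \<delta> (F xs)" "attached \<epsilon> \<delta> (F ys)" if "F xs \<noteq> F ys"
    using attached_Fop[OF xs ys] attached_Fop[OF ys xs] rel that by metis+
  then show "(F xs, F ys) \<in> theta G u v N \<epsilon> \<delta>"
    using xs ys tot by (simp add: theta_iff[OF N]) blast
qed

text \<open>The parameters are read off from test pairs: \<open>(Elem n, Elem \<one>)\<close>
  detects \<open>n \<in> N\<close>, while \<open>(PtA, Elem u)\<close> and
  \<open>(PtB, Elem v)\<close> detect the flags.\<close>

lemma theta_subset_iff:
  assumes N: "subgroup N G" and N': "subgroup N' G"
  shows "theta G u v N \<epsilon> \<delta> \<subseteq> theta G u v N' \<epsilon>' \<delta>' \<longleftrightarrow> N \<subseteq> N' \<and> \<epsilon> \<le> \<epsilon>' \<and> \<delta> \<le> \<delta>'"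
proof
  assume sub: "theta G u v N \<epsilon> \<delta> \<subseteq> theta G u v N' \<epsilon>' \<delta>'"
  have "N \<subseteq> N'"
  proof
    fix n assume n: "n \<in> N"
    then have nG: "n \<in> carrier G" using subgroup.mem_carrier[OF N] by blast
    then have "(Elem n, Elem \<one>) \<in> theta G u v N \<epsilon> \<delta>"
      using n by (simp add: theta_iff[OF N] r_coset_eq_iff[OF N])
    then have "(Elem n, Elem \<one>) \<in> theta G u v N' \<epsilon>' \<delta>'" using sub by blast
    then show "n \<in> N'"
      using nG subgroup.one_closed[OF N'] by (auto simp: theta_iff[OF N'] r_coset_eq_iff[OF N'])
  qed
  moreover have "(PtA, Elem u) \<in> theta G u v N \<epsilon> \<delta> \<longleftrightarrow> \<epsilon>"
    "(PtB, Elem v) \<in> theta G u v N \<epsilon> \<delta> \<longleftrightarrow> \<delta>"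
    "(PtA, Elem u) \<in> theta G u v N' \<epsilon>' \<delta>' \<longleftrightarrow> \<epsilon>'"
    "(PtB, Elem v) \<in> theta G u v N' \<epsilon>' \<delta>' \<longleftrightarrow> \<delta>'"
    by (simp_all add: theta_iff[OF N] theta_iff[OF N'])
  ultimately show "N \<subseteq> N' \<and> \<epsilon> \<le> \<epsilon>' \<and> \<delta> \<le> \<delta>'" using sub by auto
next
  assume le: "N \<subseteq> N' \<and> \<epsilon> \<le> \<epsilon>' \<and> \<delta> \<le> \<delta>'"
  then have att: "attached \<epsilon> \<delta> x \<Longrightarrow> attached \<epsilon>' \<delta>' x" for x
    by (cases x) auto
  show "theta G u v N \<epsilon> \<delta> \<subseteq> theta G u v N' \<epsilon>' \<delta>'"
  proof (rule subrelI)
    fix x y assume "(x, y) \<in> theta G u v N \<epsilon> \<delta>"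
    then show "(x, y) \<in> theta G u v N' \<epsilon>' \<delta>'"
      using le att by (auto simp: theta_iff[OF N] theta_iff[OF N'] r_coset_eq_iff[OF N]
          r_coset_eq_iff[OF N'])
  qed
qed

subsection \<open>Classification of the congruences\<close>

text \<open>A common weakening of ordinary congruences and of the carrier part of typed ones:
  position 1 is a carrier position, and all other entries stay fixed.\<close>

definition first_translations :: "'a ext rel \<Rightarrow> bool" where
  "first_translations \<theta> \<longleftrightarrow>
     (\<forall>x y zs. (x, y) \<in> \<theta> \<longrightarrow> zs \<in> tuples (m - 1) X \<longrightarrow> (F (x # zs), F (y # zs)) \<in> \<theta>)"

section \<open>Values of the operation on the tuples used for translations\<close>

lemma Fop_Elem:
  assumes "xs \<in> tuples m X" "y \<in> set xs" "z \<in> set xs" "y \<noteq> z"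
  shows "F xs = Elem (total xs)"
proof -
  have "set xs \<noteq> {c}" for c using assms(2-4) by (metis singletonD)
  then show ?thesis using Fop_eq[OF assms(1)] by simp
qed

text \<open>The entry \<open>Elem g\<close> excludes both special cases, so the value is a group
  product even when \<open>x\<close> is \<open>PtA\<close> or \<open>PtB\<close>.\<close>

lemma Fop_Cons_ones:
  assumes "x \<in> X" "g \<in> carrier G"
  shows "F (x # Elem g # replicate (m - 2) (Elem \<one>)) = Elem (\<tau> x \<otimes> g)"
proof -
  have "x # Elem g # replicate (m - 2) (Elem \<one>) \<in> tuples m X"
    using assms m_ge by (auto simp: tuples_def)
  moreover have "Elem g \<in> set (x # Elem g # replicate (m - 2) (Elem \<one>))" by simp
  ultimately show ?thesis
    using assms by (auto simp: Fop_eq set_eq_iff)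
qed

text \<open>The \<open>m - 1\<close> copies of \<open>x\<close> cancel by the exponent condition,
  and \<open>x \<noteq> y\<close> excludes a constant tuple, so \<open>y\<close> is replaced by its
  \<open>\<tau>\<close>-image.\<close>

lemma Fop_Cons_replicate:
  assumes "x \<in> X" "y \<in> X" "x \<noteq> y"
  shows "F (y # replicate (m - 1) x) = Elem (\<tau> y)"
proof -
  have t: "y # replicate (m - 1) x \<in> tuples m X"
    using assms m_ge by (auto simp: tuples_def)
  have "x \<in> set (y # replicate (m - 1) x)" using m_ge by simp
  then show ?thesis
    using Fop_Elem[OF t _ _ assms(3)] assms exponent by simp
qed

lemma Fop_replicate:
  assumes "x \<in> X"
  shows "F (x # replicate (m - 1) x) = x"
proof -
  have "m = Suc (m - 1)" using m_ge by linarith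
  then have "x # replicate (m - 1) x = replicate m x" by (metis replicate_Suc)
  then show ?thesis using idempotent_Fop assms by (simp add: idempotent_op_def)
qed

text \<open>Distinctness in the second claim is essential: for \<open>x = y\<close> it would say
  that every point is related to its own \<open>\<tau>\<close>-image, which fails for a detached
  \<open>PtA\<close> or \<open>PtB\<close>.\<close>

lemma translations_related:
  assumes eq: "equiv X \<theta>" and tr: "first_translations \<theta>" and xy: "(x, y) \<in> \<theta>"
  shows "g \<in> carrier G \<Longrightarrow> (Elem (\<tau> x \<otimes> g), Elem (\<tau> y \<otimes> g)) \<in> \<theta>"
    and "x \<noteq> y \<Longrightarrow> (x, Elem (\<tau> y)) \<in> \<theta>"
proof -
  have X: "x \<in> X" "y \<in> X" using eq xy by (auto simp: equiv_def refl_on_def)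
  show "(Elem (\<tau> x \<otimes> g), Elem (\<tau> y \<otimes> g)) \<in> \<theta>" if g: "g \<in> carrier G"
  proof -
    have "Elem g # replicate (m - 2) (Elem \<one>) \<in> tuples (m - 1) X"
      using g m_ge by (auto simp: tuples_def)
    then show ?thesis
      using tr xy Fop_Cons_ones[OF X(1) g] Fop_Cons_ones[OF X(2) g]
      unfolding first_translations_def by metis
  qed
  show "(x, Elem (\<tau> y)) \<in> \<theta>" if "x \<noteq> y"
  proof -
    have "replicate (m - 1) x \<in> tuples (m - 1) X" using X by (auto simp: tuples_def)
    then show ?thesis
      using tr xy Fop_Cons_replicate[OF X that] Fop_replicate[OF X(1)]
      unfolding first_translations_def by metis
  qed
qed

lemma first_translations_theta:
  assumes eq: "equiv X \<theta>" and tr: "first_translations \<theta>"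
  shows "\<exists>N \<epsilon> \<delta>. subgroup N G \<and> \<theta> = theta G u v N \<epsilon> \<delta>"
proof -
  \<comment> \<open>\<open>N\<close> is the class of the identity within the group; each flag
    records whether its point is related to its \<open>\<tau>\<close>-image.\<close>
  define N where "N = {n \<in> carrier G. (Elem n, Elem \<one>) \<in> \<theta>}"
  define \<epsilon> \<delta> where "\<epsilon> \<longleftrightarrow> (PtA, Elem u) \<in> \<theta>" and "\<delta> \<longleftrightarrow> (PtB, Elem v) \<in> \<theta>"
  have refl: "x \<in> X \<Longrightarrow> (x, x) \<in> \<theta>" and subX: "(x, y) \<in> \<theta> \<Longrightarrow> x \<in> X \<and> y \<in> X" for x y
    using eq by (auto simp: equiv_def refl_on_def)
  have sym: "(x, y) \<in> \<theta> \<Longrightarrow> (y, x) \<in> \<theta>" for x y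
    using eq by (auto simp: equiv_def sym_def)
  have trans: "(x, y) \<in> \<theta> \<Longrightarrow> (y, z) \<in> \<theta> \<Longrightarrow> (x, z) \<in> \<theta>" for x y z
    using eq by (auto simp: equiv_def trans_def)
  have mult: "(Elem (\<tau> x \<otimes> g), Elem (\<tau> y \<otimes> g)) \<in> \<theta>" if "(x, y) \<in> \<theta>" "g \<in> carrier G" for x y g
    using translations_related(1)[OF eq tr] that .
  have tau: "(Elem (\<tau> x), Elem (\<tau> y)) \<in> \<theta>" if "(x, y) \<in> \<theta>" for x y
    using mult[OF that one_closed] subX[OF that] by simp
  have N: "subgroup N G"
  proof (rule subgroupI)
    show "N \<subseteq> carrier G" by (auto simp: N_def)
    show "N \<noteq> {}" using refl[of "Elem \<one>"] by (auto simp: N_def)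
    show "inv n \<in> N" if "n \<in> N" for n
      using that mult[of "Elem n" "Elem \<one>" "inv n"] sym by (auto simp: N_def)
    show "n \<otimes> k \<in> N" if "n \<in> N" "k \<in> N" for n k
      using that mult[of "Elem n" "Elem \<one>" k] trans by (auto simp: N_def)
  qed
  have coset: "N #> g = N #> h \<longleftrightarrow> (Elem g, Elem h) \<in> \<theta>"
    if gh: "g \<in> carrier G" "h \<in> carrier G" for g h
  proof -
    \<comment> \<open>Translation by \<open>h\<close> gives one direction, translation by
      \<open>inv h\<close> the other.\<close>
    have "g \<otimes> inv h \<in> N \<longleftrightarrow> (Elem g, Elem h) \<in> \<theta>"
      using gh mult[of "Elem (g \<otimes> inv h)" "Elem \<one>" h] mult[of "Elem g" "Elem h" "inv h"]
      by (auto simp: N_def m_assoc)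
    then show ?thesis using r_coset_eq_iff[OF N gh] by simp
  qed
  have att: "attached \<epsilon> \<delta> x \<longleftrightarrow> (x, Elem (\<tau> x)) \<in> \<theta>" if "x \<in> X" for x
    using that refl by (cases x) (auto simp: \<epsilon>_def \<delta>_def)
  have "(x, y) \<in> \<theta> \<longleftrightarrow> (x, y) \<in> theta G u v N \<epsilon> \<delta>" for x y
  proof
    assume xy: "(x, y) \<in> \<theta>"
    have X: "x \<in> X" "y \<in> X" using subX[OF xy] by auto
    show "(x, y) \<in> theta G u v N \<epsilon> \<delta>"
    proof (cases "x = y")
      case False
      have "(x, Elem (\<tau> y)) \<in> \<theta>" using translations_related(2)[OF eq tr xy False] .
      \<comment> \<open>The chains are \<open>x\<close>, \<open>\<tau> y\<close>,
        \<open>\<tau> x\<close> and \<open>y\<close>, \<open>x\<close>, \<open>\<tau> y\<close>; so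
        distinct related points are both attached.\<close>
      then have "(x, Elem (\<tau> x)) \<in> \<theta>" "(y, Elem (\<tau> y)) \<in> \<theta>"
        using trans sym tau[OF xy] xy by blast+
      then show ?thesis using X tau[OF xy] by (simp add: theta_iff[OF N] att coset)
    qed (use X in \<open>simp add: theta_iff[OF N]\<close>)
  next
    assume "(x, y) \<in> theta G u v N \<epsilon> \<delta>"
    then have X: "x \<in> X" "y \<in> X" and "x = y \<or> (x, Elem (\<tau> x)) \<in> \<theta> \<and> (y, Elem (\<tau> y)) \<in> \<theta> \<and>
        (Elem (\<tau> x), Elem (\<tau> y)) \<in> \<theta>"
      by (auto simp: theta_iff[OF N] att coset)
    then show "(x, y) \<in> \<theta>" using refl trans sym by metis
  qed
  then have "\<theta> = theta G u v N \<epsilon> \<delta>" by (metis subrelI subset_antisym)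
  then show ?thesis using N by blast
qed

lemma Con_first_translations:
  assumes "\<theta> \<in> Con m X F"
  shows "first_translations \<theta>"
  unfolding first_translations_def
proof (intro allI impI)
  fix x y zs assume xy: "(x, y) \<in> \<theta>" and zs: "zs \<in> tuples (m - 1) X"
  have eq: "equiv X \<theta>" using assms by (simp add: Con_def)
  then have X: "x \<in> X" "y \<in> X" and refl: "\<And>z. z \<in> X \<Longrightarrow> (z, z) \<in> \<theta>"
    using xy by (auto simp: equiv_def refl_on_def)
  have "x # zs \<in> tuples m X" "y # zs \<in> tuples m X"
    using X zs m_ge by (auto simp: tuples_def)
  moreover have "\<forall>i<m. ((x # zs) ! i, (y # zs) ! i) \<in> \<theta>"
    using xy zs refl by (auto simp: tuples_def nth_Cons subset_iff split: nat.split)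
  ultimately show "(F (x # zs), F (y # zs)) \<in> \<theta>" using assms by (simp add: Con_def)
qed

section \<open>The classification and the lattice isomorphism\<close>

lemma Con_eq: "Con m X F = {theta G u v N \<epsilon> \<delta> | N \<epsilon> \<delta>. subgroup N G}"
proof (intro equalityI subsetI)
  fix \<theta> assume \<theta>: "\<theta> \<in> Con m X F"
  then have "equiv X \<theta>" by (simp add: Con_def)
  then show "\<theta> \<in> {theta G u v N \<epsilon> \<delta> | N \<epsilon> \<delta>. subgroup N G}"
    using first_translations_theta[OF _ Con_first_translations[OF \<theta>]] by blast
qed (use theta_in_Con in blast)

text \<open>\<open>theta_subset_iff\<close> yields both the order equivalence and injectivity;
  surjectivity is \<open>Con_eq\<close>.\<close>

lemma lattice_iso_theta:
  "lattice_iso (prod_order (Sub G) B2) (inclusion_order (Con m X F))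
     (\<lambda>(N, \<epsilon>, \<delta>). theta G u v N \<epsilon> \<delta>)"
proof (rule lattice_iso_of_order_iso)
  let ?f = "\<lambda>(N, \<epsilon>, \<delta>). theta G u v N \<epsilon> \<delta>" and ?P = "prod_order (Sub G) B2"
  show "lattice ?P" by (intro lattice_prod_order lattice_Sub lattice_B2)
  show "partial_order (inclusion_order (Con m X F))" by (rule partial_order_inclusion_order)
  have P: "carrier ?P = {N. subgroup N G} \<times> UNIV"
    by (auto simp: prod_order_def Sub_def inclusion_order_def B2_def chain2_def)
  show "?f x \<sqsubseteq>\<^bsub>inclusion_order (Con m X F)\<^esub> ?f y \<longleftrightarrow> x \<sqsubseteq>\<^bsub>?P\<^esub> y"
    if "x \<in> carrier ?P" "y \<in> carrier ?P" for x y
    using that unfolding P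
    by (cases x, cases y) (simp add: theta_subset_iff prod_order_def Sub_def inclusion_order_def
        B2_def chain2_def)
  have "inj_on ?f (carrier ?P)"
    unfolding P
  proof (rule inj_onI)
    fix x y assume xy: "x \<in> {N. subgroup N G} \<times> UNIV" "y \<in> {N. subgroup N G} \<times> UNIV" "?f x = ?f y"
    obtain N \<epsilon> \<delta> where x: "x = (N, \<epsilon>, \<delta>)" by (rule prod_cases3)
    obtain N' \<epsilon>' \<delta>' where y: "y = (N', \<epsilon>', \<delta>')" by (rule prod_cases3)
    have N: "subgroup N G" and N': "subgroup N' G"
      and "theta G u v N \<epsilon> \<delta> = theta G u v N' \<epsilon>' \<delta>'"
      using xy by (simp_all add: x y)
    then have "N \<subseteq> N' \<and> \<epsilon> \<le> \<epsilon>' \<and> \<delta> \<le> \<delta>'" "N' \<subseteq> N \<and> \<epsilon>' \<le> \<epsilon> \<and> \<delta>' \<le> \<delta>"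
      using theta_subset_iff[OF N N', of \<epsilon> \<delta> \<epsilon>' \<delta>'] theta_subset_iff[OF N' N, of \<epsilon>' \<delta>' \<epsilon> \<delta>]
      by simp_all
    then show "x = y" unfolding x y by (metis order_antisym)
  qed
  moreover have "?f ` carrier ?P = Con m X F"
  proof (intro equalityI subsetI)
    fix \<theta> assume "\<theta> \<in> Con m X F"
    then obtain N \<epsilon> \<delta> where "subgroup N G" "\<theta> = theta G u v N \<epsilon> \<delta>"
      unfolding Con_eq by blast
    then show "\<theta> \<in> ?f ` carrier ?P"
      unfolding P by (intro image_eqI[of _ _ "(N, \<epsilon>, \<delta>)"]) simp_all
  qed (use theta_in_Con in \<open>auto simp: P\<close>)
  ultimately show "bij_betw ?f (carrier ?P) (carrier (inclusion_order (Con m X F)))"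
    by (simp add: bij_betw_def inclusion_order_def)
qed

subsection \<open>Typed congruences\<close>

lemma typed_congruence_first_translations:
  assumes "typed_congruence m X F \<theta> \<phi>"
  shows "first_translations \<theta>"
  unfolding first_translations_def
proof (intro allI impI)
  fix x y zs assume xy: "(x, y) \<in> \<theta>" and zs: "zs \<in> tuples (m - 1) X"
  have eq: "equiv X \<theta>" "equiv X \<phi>" using assms by (auto simp: typed_congruence_def)
  then have X: "x \<in> X" "y \<in> X" and refl: "\<And>z. z \<in> X \<Longrightarrow> (z, z) \<in> \<theta> \<and> (z, z) \<in> \<phi>"
    using xy by (auto simp: equiv_def refl_on_def)
  have "x # zs \<in> tuples m X" "y # zs \<in> tuples m X"
    using X zs m_ge by (auto simp: tuples_def)
  moreover have "\<forall>i<m. even i \<longrightarrow> ((x # zs) ! i, (y # zs) ! i) \<in> \<theta>"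
    "\<forall>i<m. odd i \<longrightarrow> ((x # zs) ! i, (y # zs) ! i) \<in> \<phi>"
    using xy zs refl by (auto simp: tuples_def nth_Cons subset_iff split: nat.split)
  ultimately show "(F (x # zs), F (y # zs)) \<in> \<theta>"
    using assms unfolding typed_congruence_def by blast
qed

text \<open>Moves a change made in position 2, the first index position, to the front, where the
  formulas for special tuples are stated.\<close>

lemma Fop_swap:
  assumes "x # y # zs \<in> tuples m X"
  shows "F (x # y # zs) = F (y # x # zs)"
proof (rule Fop_cong)
  show "total (x # y # zs) = total (y # x # zs)"
    using assms by (intro total_permute) (auto simp: tuples_def)
qed (use assms in \<open>auto simp: tuples_def\<close>)

lemma typed_congruence_index_subset:
  assumes tc: "typed_congruence m X F \<theta> \<phi>"
  shows "\<phi> \<subseteq> \<theta>"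
proof (rule subrelI)
  fix x y assume xy: "(x, y) \<in> \<phi>"
  have eq: "equiv X \<theta>" "equiv X \<phi>" using tc by (auto simp: typed_congruence_def)
  then have X: "x \<in> X" "y \<in> X" and refl: "\<And>z. z \<in> X \<Longrightarrow> (z, z) \<in> \<theta> \<and> (z, z) \<in> \<phi>"
    using xy by (auto simp: equiv_def refl_on_def)
  have sym: "(p, q) \<in> \<theta> \<Longrightarrow> (q, p) \<in> \<theta>" "(p, q) \<in> \<phi> \<Longrightarrow> (q, p) \<in> \<phi>" for p q
    using eq by (auto simp: equiv_def sym_def)
  have trans: "(p, q) \<in> \<theta> \<Longrightarrow> (q, r) \<in> \<theta> \<Longrightarrow> (p, r) \<in> \<theta>" for p q r
    using eq by (auto simp: equiv_def trans_def)
  \<comment> \<open>A \<open>\<phi>\<close>-change is legitimate at list index 1; after swapping it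
    acts like a translation in the first entry, with values related by
    \<open>\<theta>\<close>.\<close>
  have second: "(F (p # z # zs), F (q # z # zs)) \<in> \<theta>"
    if pq: "(p, q) \<in> \<phi>" and "z # zs \<in> tuples (m - 1) X" for p q z zs
  proof -
    have pX: "p \<in> X" "q \<in> X" using pq eq(2) by (auto simp: equiv_def refl_on_def)
    have t: "p # z # zs \<in> tuples m X" "q # z # zs \<in> tuples m X"
      "z # p # zs \<in> tuples m X" "z # q # zs \<in> tuples m X"
      using that pX m_ge by (auto simp: tuples_def)
    have "\<forall>i<m. even i \<longrightarrow> ((z # p # zs) ! i, (z # q # zs) ! i) \<in> \<theta>"
      "\<forall>i<m. odd i \<longrightarrow> ((z # p # zs) ! i, (z # q # zs) ! i) \<in> \<phi>"
      using pq t refl by (auto simp: tuples_def nth_Cons subset_iff split: nat.split)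
    then have "(F (z # p # zs), F (z # q # zs)) \<in> \<theta>"
      using tc t unfolding typed_congruence_def by blast
    then show ?thesis using Fop_swap t by simp
  qed
  show "(x, y) \<in> \<theta>"
  proof (cases "x = y")
    case False
    have half: "(p, Elem (\<tau> q)) \<in> \<theta>" if "(p, q) \<in> \<phi>" "p \<in> X" "q \<in> X" "p \<noteq> q" for p q
    proof -
      \<comment> \<open>One copy of \<open>p\<close> is split off to serve as the entry
        \<open>z\<close> of \<open>second\<close>.\<close>
      have "m - 1 = Suc (m - 2)" using m_ge by linarith
      then have r: "replicate (m - 1) p = p # replicate (m - 2) p"
        by (metis replicate_Suc)
      have "replicate (m - 1) p \<in> tuples (m - 1) X" using that by (auto simp: tuples_def)
      then have "(F (p # replicate (m - 1) p), F (q # replicate (m - 1) p)) \<in> \<theta>"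
        using second[OF that(1)] unfolding r by blast
      then show ?thesis
        using Fop_replicate[OF that(2)] Fop_Cons_replicate[OF that(2-4)] by simp
    qed
    have "Elem \<one> # replicate (m - 2) (Elem \<one>) \<in> tuples (m - 1) X"
      using m_ge by (auto simp: tuples_def)
    from second[OF xy this] have "(Elem (\<tau> x), Elem (\<tau> y)) \<in> \<theta>"
      using Fop_Cons_ones[OF X(1) one_closed] Fop_Cons_ones[OF X(2) one_closed] X by simp
    \<comment> \<open>The chain is \<open>x\<close>, \<open>\<tau> y\<close>,
      \<open>\<tau> x\<close>, \<open>y\<close>, whose outer links are the two instances of
      \<open>half\<close>.\<close>
    then show ?thesis
      using half[OF xy X False] half[OF sym(2)[OF xy]] X False sym(1) trans by metis
  qed (use X refl in auto)
qed

lemma typed_congruence_iff: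
  assumes "equiv X \<theta>" "equiv X \<phi>"
  shows "typed_congruence m X F \<theta> \<phi> \<longleftrightarrow> \<theta> \<in> Con m X F \<and> \<phi> \<subseteq> \<theta>"
proof
  assume tc: "typed_congruence m X F \<theta> \<phi>"
  \<comment> \<open>A typed congruence permits \<open>\<theta>\<close>-changes only in carrier
    positions; compatibility in the index positions comes from the classification, since every
    \<open>theta\<close> of a subgroup is a congruence.\<close>
  have "\<theta> \<in> Con m X F"
    using first_translations_theta[OF assms(1) typed_congruence_first_translations[OF tc]] Con_eq
    by blast
  then show "\<theta> \<in> Con m X F \<and> \<phi> \<subseteq> \<theta>" using typed_congruence_index_subset[OF tc] by blast
next
  assume "\<theta> \<in> Con m X F \<and> \<phi> \<subseteq> \<theta>"
  \<comment> \<open>By \<open>\<phi> \<subseteq> \<theta>\<close> the entries are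
    \<open>\<theta>\<close>-related in every position, so ordinary compatibility applies.\<close>
  then show "typed_congruence m X F \<theta> \<phi>"
    using assms unfolding typed_congruence_def Con_def by blast
qed

end

theorem theorem5p1:
  fixes G :: "('g, 'k) monoid_scheme" and u v :: 'g and m :: nat
  assumes "m \<ge> 3" and "odd m"
    and "comm_group G"
    and "\<forall>g \<in> carrier G. g [^]\<^bsub>G\<^esub> (m - 1) = \<one>\<^bsub>G\<^esub>"
    and "u \<in> carrier G" and "v \<in> carrier G"
  shows "mary_semigroup m (ext_carrier G) (Fop m G u v)
    \<and> symmetric_op m (ext_carrier G) (Fop m G u v)
    \<and> idempotent_op m (ext_carrier G) (Fop m G u v)
    \<and> Con m (ext_carrier G) (Fop m G u v) = {theta G u v N \<epsilon> \<delta> | N \<epsilon> \<delta>. subgroup N G}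
    \<and> lattice_iso (prod_order (Sub G) B2)
        (inclusion_order (Con m (ext_carrier G) (Fop m G u v)))
        (\<lambda>(N, \<epsilon>, \<delta>). theta G u v N \<epsilon> \<delta>)
    \<and> (\<forall>\<theta> \<phi>. equiv (ext_carrier G) \<theta> \<longrightarrow> equiv (ext_carrier G) \<phi> \<longrightarrow>
         (typed_congruence m (ext_carrier G) (Fop m G u v) \<theta> \<phi> \<longleftrightarrow>
          \<theta> \<in> Con m (ext_carrier G) (Fop m G u v) \<and> \<phi> \<subseteq> \<theta>))"
proof -
  interpret comm_group G by fact
  interpret extended_group G m u v
    by unfold_locales (use assms in blast)+
  show ?thesis
  proof (intro conjI allI impI)
    show "typed_congruence m X F \<theta> \<phi> \<longleftrightarrow> \<theta> \<in> Con m X F \<and> \<phi> \<subseteq> \<theta>"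
      if "equiv X \<theta>" "equiv X \<phi>" for \<theta> \<phi>
      using that by (rule typed_congruence_iff)
  qed (fact mary_semigroup_Fop symmetric_Fop idempotent_Fop Con_eq lattice_iso_theta)+
qed

end
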